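(* If $f\in\mathrm{DC}(\mathbb{R}^d)$ then $\mathrm{graph}\,\partial f\subset T^*\mathbb{R}^d\cong\mathbb{R}^d\times\mathbb{R}^d$ has locally finite $d$-content.
   Context: $f:\mathbb{R}^d\to\mathbb{R}$ is DC if every point of $\mathbb{R}^d$ has a convex neighborhood on which $f=g-h$ with $g,h$ convex. $\partial f(x)$ is the Clarke differential: the convex hull of all limits $\lim_i df(x_i)$ with $x_i\to x$ and $f$ differentiable at each $x_i$; $\mathrm{graph}\,\partial f=\{(x,\xi):\xi\in\partial f(x)\}$. For $S\subset\mathbb{R}^n$, $\mathcal{M}^{*m}(S)=\limsup_{\varepsilon\downarrow0}(2\varepsilon)^{m-n}\operatorname{Vol}(S_\varepsilon)$, where $S_\varepsilon$ is the set of points within distance $\varepsilon$ of $S$; $S$ has finite $m$-content if $\mathcal{M}^{*m}(S)<\infty$, and locally finite $m$-content if its intersection with every compact subset of $\mathbb{R}^n$ has finite $m$-content. *)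

theory Defs
  imports "HOL-Analysis.Analysis"
begin

definition DC :: "('a::euclidean_space \<Rightarrow> real) \<Rightarrow> bool" where
  "DC f \<longleftrightarrow> (\<forall>x. \<exists>U g h. convex U \<and> x \<in> interior U \<and> convex_on U g \<and> convex_on U h \<and>
                       (\<forall>y\<in>U. f y = g y - h y))"

text \<open>Covectors are identified with vectors by means of the Euclidean inner product, so the
  differential \<open>df(x)\<close> is represented by the gradient.\<close>

definition clarke_diff :: "('a::euclidean_space \<Rightarrow> real) \<Rightarrow> 'a \<Rightarrow> 'a set" where
  "clarke_diff f x = convex hull
     {\<xi>. \<exists>X G. X \<longlonglongrightarrow> x \<and> (\<forall>i. GDERIV f (X i) :> G i) \<and> G \<longlonglongrightarrow> \<xi>}"

definition clarke_graph :: "('a::euclidean_space \<Rightarrow> real) \<Rightarrow> ('a \<times> 'a) set" where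
  "clarke_graph f = {(x, \<xi>). \<xi> \<in> clarke_diff f x}"

text \<open>The nonemptiness condition is needed because \<^term>\<open>infdist x {} = 0\<close>; the tube
  around the empty set is empty. Tubes are closed, hence measurable, for every \<open>S\<close>.\<close>

definition tube :: "'a::euclidean_space set \<Rightarrow> real \<Rightarrow> 'a set" where
  "tube S \<epsilon> = {x. S \<noteq> {} \<and> infdist x S \<le> \<epsilon>}"

definition upper_content :: "nat \<Rightarrow> 'a::euclidean_space set \<Rightarrow> ennreal" where
  "upper_content m S = Limsup (at_right 0)
     (\<lambda>\<epsilon>. ennreal ((2 * \<epsilon>) powr (real m - real DIM('a))) * emeasure lebesgue (tube S \<epsilon>))"

definition finite_content :: "nat \<Rightarrow> 'a::euclidean_space set \<Rightarrow> bool" where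
  "finite_content m S \<longleftrightarrow> upper_content m S < \<infinity>"

definition locally_finite_content :: "nat \<Rightarrow> 'a::euclidean_space set \<Rightarrow> bool" where
  "locally_finite_content m S \<longleftrightarrow> (\<forall>K. compact K \<longrightarrow> finite_content m (S \<inter> K))"

end

theory Submission
  imports Defs
begin

text \<open>
  Locally \<open>f = g - h\<close> with \<open>g, h\<close> convex, and the convex function \<open>\<phi> = g + h\<close> controls \<open>f\<close>: every
  Clarke covector \<open>p\<close> at \<open>x\<close> is accompanied by a subgradient \<open>q\<close> of \<open>\<phi>\<close> at \<open>x\<close> such that the
  first-order error of \<open>f\<close> with slope \<open>p\<close> is bounded by that of \<open>\<phi>\<close> with slope \<open>q\<close>
  (\<open>clarke_diff_control\<close>). This reduces the theorem to a statement about the single convex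
  function \<open>\<phi>\<close>, whose graph of subgradients is parametrized by \<open>w = x + q\<close> (Minty). The difficulty is
  that \<open>p\<close> need not be a Lipschitz function of \<open>w\<close>: where \<open>g\<close> and \<open>h\<close> bend sharply along nearly parallel
  ridges, a small range of \<open>w\<close> may carry a large range of \<open>p\<close>.

  The remedy is to measure the range of \<open>p\<close> and a range of \<open>w\<close> by the same convex body. With the
  gap \<open>u y = \<phi> y - \<phi> x - q \<bullet> (y - x)\<close>, let \<open>D\<close> be the set of all \<open>r\<close> with
  \<open>\<bar>r \<bullet> (y - x)\<bar> \<le> \<epsilon>\<^sup>2 + u y + (norm (y - x))\<^sup>2\<close> for all \<open>y\<close>, and attach to \<open>(x, p)\<close> the cell
  \<open>x + q + D / 4\<close> in the space of the parameter \<open>w\<close>. If the cells of \<open>(x, p)\<close> and \<open>(x', p')\<close> meet,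
  then \<open>x\<close> and \<open>x'\<close> are within \<open>\<epsilon>\<close> (\<open>minty_cells_meet_imp_near\<close>), each of the two gaps is bounded by
  a multiple of \<open>\<epsilon>\<^sup>2 + u y + (norm (y - x))\<^sup>2\<close>, and therefore \<open>p' - p \<in> 4 D\<close> (\<open>minty_cells_meet_imp_slopes_near\<close>).

  Now choose a maximal disjoint family of cells (\<open>maximal_disjoint_subfamily\<close>). Every cell meets a
  chosen one, so the tube of radius \<open>2 \<epsilon>\<close> is covered by the sets \<open>cball x (3 * \<epsilon>) \<times> (p + 5 D)\<close> that
  belong to the chosen cells. Their volumes are \<open>\<epsilon>\<^sup>d\<close> times a constant times the volume of the chosen
  cells, and these are disjoint subsets of a fixed ball. Hence the tube has volume \<open>O(\<epsilon>\<^sup>d)\<close>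
  (\<open>controlled_slopes_tube_bound\<close>); as the graph lies in dimension \<open>2 d\<close>, that is finite
  \<open>d\<close>-content, and compactness passes from small balls to arbitrary compact sets.
\<close>

section \<open>Clarke covectors of a difference of convex functions\<close>

text \<open>The point \<open>(x, h x)\<close> is separated from the strict epigraph; as \<open>x\<close> is interior to the domain,
  the separating hyperplane is not vertical and is the graph of the desired affine minorant.\<close>

lemma convex_on_subgradient_exists:
  fixes h :: "'a::euclidean_space \<Rightarrow> real"
  assumes h: "convex_on W h" and W: "open W" and x: "x \<in> W"
  obtains \<eta> where "\<And>y. y \<in> W \<Longrightarrow> h x + \<eta> \<bullet> (y - x) \<le> h y"
proof -
  let ?E = "{z. x + fst z \<in> W \<and> h (x + fst z) < h x + snd z}"
  have "convex W" using h by (rule convex_on_imp_convex)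
  have "convex ?E"
  proof (rule convexI, clarsimp)
    fix v s w t and a b :: real
    assume v: "x + v \<in> W" "h (x + v) < h x + s" and w: "x + w \<in> W" "h (x + w) < h x + t"
      and ab: "0 \<le> a" "0 \<le> b" "a + b = 1"
    have "a *\<^sub>R (x + v) + b *\<^sub>R (x + w) = (a + b) *\<^sub>R x + (a *\<^sub>R v + b *\<^sub>R w)"
      by (simp add: algebra_simps)
    then have eq: "x + (a *\<^sub>R v + b *\<^sub>R w) = a *\<^sub>R (x + v) + b *\<^sub>R (x + w)"
      using ab by simp
    have "h (a *\<^sub>R (x + v) + b *\<^sub>R (x + w)) \<le> a * h (x + v) + b * h (x + w)"
      using h v w ab unfolding convex_on_def by blast
    also have "\<dots> < a * (h x + s) + b * (h x + t)"
    proof (cases "a = 0")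
      case True
      then show ?thesis using ab w by simp
    next
      case False
      then show ?thesis using ab v w
        by (intro add_less_le_mono mult_strict_left_mono mult_left_mono) auto
    qed
    also have "\<dots> = (a + b) * h x + (a * s + b * t)"
      by (simp add: algebra_simps)
    also have "\<dots> = h x + (a * s + b * t)"
      using ab by simp
    finally show "x + (a *\<^sub>R v + b *\<^sub>R w) \<in> W \<and> h (x + (a *\<^sub>R v + b *\<^sub>R w)) < h x + (a * s + b * t)"
      using eq convexD[OF \<open>convex W\<close> v(1) w(1) ab] by simp
  qed
  moreover have "0 \<notin> ?E" by simp
  ultimately obtain c where c: "c \<noteq> 0" "\<And>z. z \<in> ?E \<Longrightarrow> 0 \<le> c \<bullet> z"
    using separating_hyperplane_set_0 by blast
  obtain a b where cab: "c = (a, b)" by (cases c)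
  have sep: "0 \<le> a \<bullet> (y - x) + b * (t - h x)" if "y \<in> W" "h y < t" for y t
    using c(2)[of "(y - x, t - h x)"] that by (simp add: cab)
  have "0 \<le> b"
    using sep[OF x, of "h x + 1"] by simp
  \<comment> \<open>A vertical hyperplane would be violated by a small step from \<open>x\<close> against its normal.\<close>
  have "b \<noteq> 0"
  proof
    assume "b = 0"
    obtain e where e: "0 < e" "cball x e \<subseteq> W"
      using W x open_contains_cball by blast
    have "a \<noteq> 0" using c(1) cab \<open>b = 0\<close> by (simp add: zero_prod_def)
    then have "x - (e / norm a) *\<^sub>R a \<in> W"
      using e by (intro subsetD[OF e(2)]) (simp add: dist_norm)
    from sep[OF this, of "h (x - (e / norm a) *\<^sub>R a) + 1"] \<open>b = 0\<close>
    have "0 \<le> - (e / norm a * (a \<bullet> a))" by simp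
    moreover have "0 < e / norm a * (a \<bullet> a)"
      using e \<open>a \<noteq> 0\<close> by (intro mult_pos_pos) auto
    ultimately show False by linarith
  qed
  then have b: "0 < b" using \<open>0 \<le> b\<close> by simp
  show thesis
  proof (rule that[of "- (1 / b) *\<^sub>R a"])
    fix y assume y: "y \<in> W"
    have "h x - (a \<bullet> (y - x)) / b \<le> h y + e" if "0 < e" for e
      using sep[OF y, of "h y + e"] b that by (simp add: field_simps)
    then have "h x - (a \<bullet> (y - x)) / b \<le> h y"
      by (rule field_le_epsilon)
    then show "h x + - (1 / b) *\<^sub>R a \<bullet> (y - x) \<le> h y" by simp
  qed
qed

text \<open>The error of the affine approximation of \<open>f\<close> with slope \<open>p\<close> at \<open>x\<close>; it is nonnegative
  everywhere exactly when \<open>p\<close> is a subgradient.\<close>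

definition affine_gap :: "('a::real_inner \<Rightarrow> real) \<Rightarrow> 'a \<Rightarrow> 'a \<Rightarrow> 'a \<Rightarrow> real" where
  "affine_gap f x p y = f y - f x - p \<bullet> (y - x)"

text \<open>Since \<open>g = f + h\<close>, the slope \<open>\<eta> + G\<close> bounds the difference quotients of \<open>g\<close> from \<open>x\<close> towards \<open>y\<close>
  from below up to an error that tends to \<open>0\<close>, and by convexity of \<open>g\<close> these quotients
  are at most \<open>g y - g x\<close>.\<close>

lemma gderiv_sum_subgradient:
  assumes g: "convex_on W g" and W: "open W" and x: "x \<in> W"
    and eq: "\<And>y. y \<in> W \<Longrightarrow> f y = g y - h y"
    and D: "GDERIV f x :> G"
    and \<eta>: "\<And>y. y \<in> W \<Longrightarrow> h x + \<eta> \<bullet> (y - x) \<le> h y"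
    and y: "y \<in> W"
  shows "g x + (\<eta> + G) \<bullet> (y - x) \<le> g y"
proof -
  let ?v = "y - x"
  have "convex W" using g by (rule convex_on_imp_convex)
  have "((\<lambda>t. f (x + t *\<^sub>R ?v)) has_derivative (\<lambda>t. (t *\<^sub>R ?v) \<bullet> G)) (at 0)"
    using D unfolding gderiv_def
    by (intro has_derivative_compose[where f = "\<lambda>t. x + t *\<^sub>R ?v" and g = f])
       (auto intro!: derivative_eq_intros)
  then have "((\<lambda>t. f (x + t *\<^sub>R ?v)) has_real_derivative (?v \<bullet> G)) (at 0)"
    by (simp add: has_field_derivative_def mult_commute_abs)
  then have "((\<lambda>t. (f (x + t *\<^sub>R ?v) - f x) / t) \<longlongrightarrow> ?v \<bullet> G) (at 0)"
    by (simp add: has_field_derivative_iff)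
  then have lim: "((\<lambda>t. (f (x + t *\<^sub>R ?v) - f x) / t) \<longlongrightarrow> ?v \<bullet> G) (at_right 0)"
    by (rule filterlim_mono[OF _ order_refl]) (simp add: at_le)
  have "\<forall>\<^sub>F t in at_right 0. (f (x + t *\<^sub>R ?v) - f x) / t \<le> g y - g x - \<eta> \<bullet> ?v"
    unfolding eventually_at_right_field
  proof (intro exI[of _ 1] conjI allI impI)
    fix t :: real assume t: "0 < t" "t < 1"
    have seg: "x + t *\<^sub>R ?v = (1 - t) *\<^sub>R x + t *\<^sub>R y" by (simp add: algebra_simps)
    have inW: "x + t *\<^sub>R ?v \<in> W"
      unfolding seg using t x y \<open>convex W\<close> by (intro convexD) auto
    have "g (x + t *\<^sub>R ?v) \<le> (1 - t) * g x + t * g y"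
      unfolding seg using g t x y unfolding convex_on_def by simp
    moreover have "h x + t * (\<eta> \<bullet> ?v) \<le> h (x + t *\<^sub>R ?v)"
      using \<eta>[OF inW] by simp
    ultimately have "f (x + t *\<^sub>R ?v) - f x \<le> t * (g y - g x - \<eta> \<bullet> ?v)"
      using eq[OF inW] eq[OF x] by (simp add: algebra_simps)
    then show "(f (x + t *\<^sub>R ?v) - f x) / t \<le> g y - g x - \<eta> \<bullet> ?v"
      using t by (simp add: field_simps)
  qed simp
  with lim have "?v \<bullet> G \<le> g y - g x - \<eta> \<bullet> ?v"
    by (intro tendsto_upperbound[OF lim]) auto
  then show ?thesis by (simp add: inner_add_left inner_commute[of "y - x" G])
qed

text \<open>With a subgradient \<open>\<eta>\<close> of \<open>h\<close> and the subgradient \<open>\<eta> + G\<close> of \<open>g\<close>, the gap of \<open>f\<close> is the difference of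
  two nonnegative gaps, and the gap of \<open>g + h\<close> with slope \<open>2 \<eta> + G\<close> is their sum.\<close>

lemma gderiv_control:
  fixes f :: "'a::euclidean_space \<Rightarrow> real"
  assumes g: "convex_on W g" and h: "convex_on W h" and W: "open W" and x: "x \<in> W"
    and eq: "\<And>y. y \<in> W \<Longrightarrow> f y = g y - h y"
    and D: "GDERIV f x :> G"
  shows "\<exists>q. \<forall>y\<in>W. \<bar>affine_gap f x G y\<bar> \<le> affine_gap (\<lambda>y. g y + h y) x q y"
proof -
  obtain \<eta> where \<eta>: "\<And>y. y \<in> W \<Longrightarrow> h x + \<eta> \<bullet> (y - x) \<le> h y"
    using convex_on_subgradient_exists[OF h W x] by blast
  show ?thesis
  proof (intro exI ballI)
    fix y assume y: "y \<in> W"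
    show "\<bar>affine_gap f x G y\<bar> \<le> affine_gap (\<lambda>y. g y + h y) x (\<eta> + (\<eta> + G)) y"
      using \<eta>[OF y] gderiv_sum_subgradient[where f = f and h = h, OF g W x eq D \<eta> y] eq[OF y] eq[OF x]
      by (simp add: affine_gap_def inner_add_left abs_le_iff)
  qed
qed

text \<open>Testing the subgradient inequality at distance \<open>\<rho> / 2\<close> in the direction of \<open>q\<close>.
  The radius \<open>3 / 2 * \<rho>\<close> keeps that test point inside the larger ball and leaves room for sequences that
  converge to a point of \<open>cball a \<rho>\<close>.\<close>

lemma subgradient_norm_bound:
  fixes \<phi> :: "'a::real_inner \<Rightarrow> real"
  assumes gap: "\<And>y. y \<in> ball a (2 * \<rho>) \<Longrightarrow> 0 \<le> affine_gap \<phi> x q y"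
    and M: "\<And>y. y \<in> ball a (2 * \<rho>) \<Longrightarrow> \<bar>\<phi> y\<bar> \<le> M"
    and x: "x \<in> ball a (3 / 2 * \<rho>)" and "0 < \<rho>"
  shows "norm q \<le> 4 * M / \<rho>"
proof (cases "q = 0")
  case True
  have "0 \<le> M" using M[of a] \<open>0 < \<rho>\<close> by fastforce
  then show ?thesis using True \<open>0 < \<rho>\<close> by simp
next
  case False
  let ?y = "x + (\<rho> / (2 * norm q)) *\<^sub>R q"
  have d: "dist x ?y = \<rho> / 2" using False \<open>0 < \<rho>\<close> by (simp add: dist_norm)
  have y: "?y \<in> ball a (2 * \<rho>)"
    using x d dist_triangle[of a ?y x] unfolding mem_ball by linarith
  have x': "x \<in> ball a (2 * \<rho>)" using x \<open>0 < \<rho>\<close> by simp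
  have "q \<bullet> (?y - x) = \<rho> / 2 * norm q"
    using False by (simp add: dot_square_norm power2_eq_square)
  then have "\<rho> / 2 * norm q \<le> 2 * M"
    using gap[OF y] M[OF y] M[OF x'] unfolding affine_gap_def by linarith
  then show ?thesis using \<open>0 < \<rho>\<close> by (simp add: field_simps)
qed

text \<open>The slopes \<open>p\<close> that are controlled at \<open>x\<close> by some \<open>q\<close> form a convex set, because the control
  inequality is jointly convex in \<open>p\<close> and \<open>q\<close>. It contains every limit of gradients: the accompanying
  subgradients are bounded, so a subsequence converges, and the inequality passes to the limit.
  Hence it contains the whole Clarke differential.\<close>

lemma clarke_diff_control:
  fixes f :: "'a::euclidean_space \<Rightarrow> real"
  assumes g: "convex_on (ball a (2 * \<rho>)) g" and h: "convex_on (ball a (2 * \<rho>)) h"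
    and eq: "\<And>y. y \<in> ball a (2 * \<rho>) \<Longrightarrow> f y = g y - h y"
    and M: "\<And>y. y \<in> ball a (2 * \<rho>) \<Longrightarrow> \<bar>g y + h y\<bar> \<le> M"
    and \<rho>: "0 < \<rho>" and x: "x \<in> cball a \<rho>" and p: "p \<in> clarke_diff f x"
  shows "\<exists>q. \<forall>y\<in>ball a (2 * \<rho>). \<bar>affine_gap f x p y\<bar> \<le> affine_gap (\<lambda>y. g y + h y) x q y"
proof -
  let ?W = "ball a (2 * \<rho>)" and ?\<phi> = "\<lambda>y. g y + h y"
  define T where "T = {p. \<exists>q. \<forall>y\<in>?W. \<bar>affine_gap f x p y\<bar> \<le> affine_gap ?\<phi> x q y}"
  have oW: "open ?W" by simp
  have xW: "x \<in> ?W" using x \<rho> by simp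
  have c\<phi>: "isCont ?\<phi> x" and cf: "isCont f x"
  proof -
    have "continuous_on ?W g" "continuous_on ?W h"
      using convex_on_continuous oW g h by blast+
    then have "continuous_on ?W (\<lambda>y. g y - h y)" "continuous_on ?W ?\<phi>"
      by (auto intro: continuous_intros)
    moreover have "continuous_on ?W f = continuous_on ?W (\<lambda>y. g y - h y)"
      using eq by (intro continuous_on_cong) auto
    ultimately show "isCont ?\<phi> x" "isCont f x"
      using xW oW by (auto simp: continuous_on_eq_continuous_at)
  qed
  have "convex T"
  proof (rule convexI)
    fix p p' and u v :: real assume "p \<in> T" "p' \<in> T" and uv: "0 \<le> u" "0 \<le> v" "u + v = 1"
    then obtain q q' where q: "\<And>y. y \<in> ?W \<Longrightarrow> \<bar>affine_gap f x p y\<bar> \<le> affine_gap ?\<phi> x q y"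
      "\<And>y. y \<in> ?W \<Longrightarrow> \<bar>affine_gap f x p' y\<bar> \<le> affine_gap ?\<phi> x q' y"
      unfolding T_def by blast
    have comb: "affine_gap k x (u *\<^sub>R r + v *\<^sub>R r') y = u * affine_gap k x r y + v * affine_gap k x r' y"
      for k :: "'a \<Rightarrow> real" and r r' y
    proof -
      have "u * affine_gap k x r y + v * affine_gap k x r' y
          = (u + v) * (k y - k x) - (u *\<^sub>R r + v *\<^sub>R r') \<bullet> (y - x)"
        by (simp add: affine_gap_def inner_add_left algebra_simps)
      then show ?thesis using uv by (simp add: affine_gap_def)
    qed
    have "\<bar>affine_gap f x (u *\<^sub>R p + v *\<^sub>R p') y\<bar> \<le> affine_gap ?\<phi> x (u *\<^sub>R q + v *\<^sub>R q') y"
      if y: "y \<in> ?W" for y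
    proof -
      have "\<bar>u * affine_gap f x p y + v * affine_gap f x p' y\<bar>
          \<le> u * \<bar>affine_gap f x p y\<bar> + v * \<bar>affine_gap f x p' y\<bar>"
        using abs_triangle_ineq[of "u * affine_gap f x p y" "v * affine_gap f x p' y"] uv
        by (simp add: abs_mult)
      also have "\<dots> \<le> u * affine_gap ?\<phi> x q y + v * affine_gap ?\<phi> x q' y"
        using uv q[OF y] by (intro add_mono mult_left_mono) auto
      finally show ?thesis by (simp only: comb)
    qed
    then show "u *\<^sub>R p + v *\<^sub>R p' \<in> T" unfolding T_def by blast
  qed
  moreover have "\<xi> \<in> T" if X: "X \<longlonglongrightarrow> x" and D: "\<And>i. GDERIV f (X i) :> G i" and G: "G \<longlonglongrightarrow> \<xi>" for \<xi> X G
  proof -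
    have "\<forall>\<^sub>F i in sequentially. X i \<in> ball a (3 / 2 * \<rho>)"
      using x \<rho> by (intro topological_tendstoD[OF X]) auto
    then obtain N where N: "\<And>i. N \<le> i \<Longrightarrow> X i \<in> ball a (3 / 2 * \<rho>)"
      by (auto simp: eventually_sequentially)
    define Y where "Y i = X (i + N)" for i
    define H where "H i = G (i + N)" for i
    have Yb: "Y i \<in> ball a (3 / 2 * \<rho>)" for i using N by (simp add: Y_def)
    then have YW: "Y i \<in> ?W" for i
      using less_trans[of "dist a (Y i)" "3 / 2 * \<rho>" "2 * \<rho>" for i] \<rho> by simp
    have "\<exists>q. \<forall>y\<in>?W. \<bar>affine_gap f (Y i) (H i) y\<bar> \<le> affine_gap ?\<phi> (Y i) q y" for i
    proof -
      have "GDERIV f (Y i) :> H i" using D by (simp add: Y_def H_def)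
      with g h oW YW eq show ?thesis
        by (rule gderiv_control)
    qed
    then obtain Q where Q: "\<And>i y. y \<in> ?W \<Longrightarrow> \<bar>affine_gap f (Y i) (H i) y\<bar> \<le> affine_gap ?\<phi> (Y i) (Q i) y"
      by metis
    have "norm (Q i) \<le> 4 * M / \<rho>" for i
    proof (rule subgradient_norm_bound[of a \<rho> ?\<phi> "Y i" "Q i" M, OF _ _ Yb \<rho>])
      fix y assume y: "y \<in> ball a (2 * \<rho>)"
      show "0 \<le> affine_gap ?\<phi> (Y i) (Q i) y"
        using Q[of y i] y by linarith
      show "\<bar>?\<phi> y\<bar> \<le> M"
        using M y by blast
    qed
    then have "bounded (range Q)" by (auto simp: bounded_iff)
    then obtain q s where s: "strict_mono s" and q: "(Q \<circ> s) \<longlonglongrightarrow> q"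
      using bounded_imp_convergent_subsequence by blast
    have Y: "(\<lambda>i. Y (s i)) \<longlonglongrightarrow> x" and H: "(\<lambda>i. H (s i)) \<longlonglongrightarrow> \<xi>"
      using LIMSEQ_subseq_LIMSEQ[OF LIMSEQ_ignore_initial_segment[OF X] s, of N]
        LIMSEQ_subseq_LIMSEQ[OF LIMSEQ_ignore_initial_segment[OF G] s, of N]
      by (simp_all add: Y_def H_def o_def)
    have "\<bar>affine_gap f x \<xi> y\<bar> \<le> affine_gap ?\<phi> x q y" if y: "y \<in> ?W" for y
    proof (rule tendsto_le[OF sequentially_bot])
      show "(\<lambda>i. affine_gap ?\<phi> (Y (s i)) (Q (s i)) y) \<longlonglongrightarrow> affine_gap ?\<phi> x q y"
        using isCont_tendsto_compose[OF c\<phi> Y] q Y unfolding affine_gap_def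
        by (auto simp: o_def intro!: tendsto_intros)
      show "(\<lambda>i. \<bar>affine_gap f (Y (s i)) (H (s i)) y\<bar>) \<longlonglongrightarrow> \<bar>affine_gap f x \<xi> y\<bar>"
        using isCont_tendsto_compose[OF cf Y] H Y unfolding affine_gap_def
        by (auto intro!: tendsto_intros)
    qed (use Q y in auto)
    then show ?thesis unfolding T_def by blast
  qed
  ultimately have "clarke_diff f x \<subseteq> T"
    unfolding clarke_diff_def by (intro hull_minimal) auto
  with p show ?thesis unfolding T_def by blast
qed

section \<open>Dual bodies and cells in the Minty parametrization\<close>

text \<open>A symmetric polar body that records how flat \<open>\<phi>\<close> is at \<open>x\<close>, relative to its subgradient \<open>q\<close>, at
  length scale \<open>\<epsilon>\<close>: it is long in the directions in which the gap grows quickly. The quadratic term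
  makes the condition harmless beyond distance \<open>\<epsilon>\<close>.\<close>

definition dual_cell :: "'a::real_inner set \<Rightarrow> ('a \<Rightarrow> real) \<Rightarrow> real \<Rightarrow> 'a \<Rightarrow> 'a \<Rightarrow> 'a set" where
  "dual_cell W \<phi> \<epsilon> x q =
     {r. \<forall>y\<in>W. \<bar>r \<bullet> (y - x)\<bar> \<le> \<epsilon>\<^sup>2 + affine_gap \<phi> x q y + (norm (y - x))\<^sup>2}"

text \<open>The factor \<open>1 / 4\<close> is small enough for the deviation from \<open>x + q\<close> to be absorbed by strong
  monotonicity of the multivalued map \<open>id + \<partial>\<phi>\<close>.\<close>

definition minty_cell :: "'a::real_inner set \<Rightarrow> ('a \<Rightarrow> real) \<Rightarrow> real \<Rightarrow> 'a \<Rightarrow> 'a \<Rightarrow> 'a set" where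
  "minty_cell W \<phi> \<epsilon> x q = (\<lambda>r. (1 / 4) *\<^sub>R r + (x + q)) ` dual_cell W \<phi> \<epsilon> x q"

lemma dual_cellD:
  "r \<in> dual_cell W \<phi> \<epsilon> x q \<Longrightarrow> y \<in> W \<Longrightarrow>
     \<bar>r \<bullet> (y - x)\<bar> \<le> \<epsilon>\<^sup>2 + affine_gap \<phi> x q y + (norm (y - x))\<^sup>2"
  by (simp add: dual_cell_def)

text \<open>The two gaps add up to \<open>(q' - q) \<bullet> (x' - x)\<close>. Replacing \<open>q' - q\<close> by means of the common point
  gives \<open>- (norm (x' - x))\<^sup>2\<close> plus two terms, each of which a dual body bounds by a quarter
  of the sum of \<open>\<epsilon>\<^sup>2\<close>, a gap and the squared distance; gap and squared distance are absorbed on the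
  left.\<close>

lemma minty_cells_meet_imp_near:
  fixes \<phi> :: "'a::real_inner \<Rightarrow> real"
  assumes x: "x \<in> W" and x': "x' \<in> W" and \<epsilon>: "0 \<le> \<epsilon>"
    and gap: "0 \<le> affine_gap \<phi> x q x'" "0 \<le> affine_gap \<phi> x' q' x"
    and r: "r \<in> dual_cell W \<phi> \<epsilon> x q" and r': "r' \<in> dual_cell W \<phi> \<epsilon> x' q'"
    and meet: "(1 / 4) *\<^sub>R r + (x + q) = (1 / 4) *\<^sub>R r' + (x' + q')"
  shows "norm (x' - x) \<le> \<epsilon>" and "affine_gap \<phi> x q x' + affine_gap \<phi> x' q' x \<le> \<epsilon>\<^sup>2"
proof -
  let ?A = "affine_gap \<phi> x q x'" and ?B = "affine_gap \<phi> x' q' x" and ?s = "(norm (x' - x))\<^sup>2"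
  have q: "q' - q = (x - x') + (1 / 4) *\<^sub>R (r - r')"
    using meet by (simp add: algebra_simps)
  have "?A + ?B = (q' - q) \<bullet> (x' - x)"
    by (simp add: affine_gap_def inner_diff_left inner_diff_right)
  also have "\<dots> = - ?s + (r \<bullet> (x' - x) - r' \<bullet> (x' - x)) / 4"
    unfolding q power2_norm_eq_inner
    by (simp add: inner_add_left inner_diff_left inner_diff_right)
       (simp add: inner_commute[of x' x] diff_divide_distrib)
  finally have eq: "?A + ?B + ?s = (r \<bullet> (x' - x) + r' \<bullet> (x - x')) / 4"
    by (simp add: inner_diff_right)
  have "\<bar>r \<bullet> (x' - x)\<bar> \<le> \<epsilon>\<^sup>2 + ?A + ?s" "\<bar>r' \<bullet> (x - x')\<bar> \<le> \<epsilon>\<^sup>2 + ?B + ?s"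
    using dual_cellD[OF r x'] dual_cellD[OF r' x] by (simp_all add: norm_minus_commute)
  with eq gap have "?s \<le> \<epsilon>\<^sup>2" "?A + ?B \<le> \<epsilon>\<^sup>2"
    using zero_le_power2[of \<epsilon>] zero_le_power2[of "norm (x' - x)"] by argo+
  then show "norm (x' - x) \<le> \<epsilon>" "?A + ?B \<le> \<epsilon>\<^sup>2"
    using \<epsilon> by (auto intro: power2_le_imp_le)
qed

text \<open>Changing \<open>(x, q)\<close> to \<open>(x', q')\<close> changes the gap by an affine function with linear part
  \<open>q - q' = (x' - x) + (r' - r) / 4\<close>. The first term is small by the previous lemma, and the dual bodies
  bound the other by the gaps themselves, with a factor that can be absorbed. So
  the gap at \<open>x'\<close> is at most three times the bound that defines the dual body at \<open>x\<close>, and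
  \<open>p\<close> and \<open>p'\<close> are slopes of approximations of the same function \<open>f\<close> up to these gaps.\<close>

lemma minty_cells_meet_imp_slopes_near:
  fixes f \<phi> :: "'a::real_inner \<Rightarrow> real"
  assumes x: "x \<in> W" and x': "x' \<in> W" and \<epsilon>: "0 \<le> \<epsilon>"
    and c: "\<And>y. y \<in> W \<Longrightarrow> \<bar>affine_gap f x p y\<bar> \<le> affine_gap \<phi> x q y"
    and c': "\<And>y. y \<in> W \<Longrightarrow> \<bar>affine_gap f x' p' y\<bar> \<le> affine_gap \<phi> x' q' y"
    and r: "r \<in> dual_cell W \<phi> \<epsilon> x q" and r': "r' \<in> dual_cell W \<phi> \<epsilon> x' q'"
    and meet: "(1 / 4) *\<^sub>R r + (x + q) = (1 / 4) *\<^sub>R r' + (x' + q')"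
    and y: "y \<in> W"
  shows "\<bar>(p' - p) \<bullet> (y - x)\<bar> \<le> 4 * (\<epsilon>\<^sup>2 + affine_gap \<phi> x q y + (norm (y - x))\<^sup>2)"
proof -
  let ?u = "affine_gap \<phi> x q" and ?u' = "affine_gap \<phi> x' q'"
  have gap: "0 \<le> ?u z" "0 \<le> ?u' z" if "z \<in> W" for z
    using c[OF that] c'[OF that] by linarith+
  note near = minty_cells_meet_imp_near[OF x x' \<epsilon> gap(1)[OF x'] gap(2)[OF x] r r' meet]
  have sq: "(norm (x' - x))\<^sup>2 \<le> \<epsilon>\<^sup>2"
    using near(1) by (intro power_mono) auto
  have young: "v \<bullet> w \<le> ((norm v)\<^sup>2 + (norm w)\<^sup>2) / 2" for v w :: 'a
    using norm_cauchy_schwarz[of v w] sum_squares_bound[of "norm v" "norm w"] by simp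
  have near_y: "(norm (y - x'))\<^sup>2 \<le> 2 * (norm (y - x))\<^sup>2 + 2 * \<epsilon>\<^sup>2"
  proof -
    have "(norm (y - x'))\<^sup>2 = (norm (y - x))\<^sup>2 + (norm (x' - x))\<^sup>2 + 2 * ((x - x') \<bullet> (y - x))"
      by (simp add: power2_norm_eq_inner inner_diff_left inner_diff_right inner_commute)
    then show ?thesis using young[of "x - x'" "y - x"] sq by (simp add: norm_minus_commute)
  qed
  have q: "q - q' = (x' - x) + (1 / 4) *\<^sub>R r' - (1 / 4) *\<^sub>R r"
    using meet by (simp add: algebra_simps)
  have "?u' y = ?u y - ?u x' + (q - q') \<bullet> (y - x')"
    by (simp add: affine_gap_def inner_diff_left inner_diff_right)
  also have "(q - q') \<bullet> (y - x') = (x' - x) \<bullet> (y - x) - (norm (x' - x))\<^sup>2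
      + (r' \<bullet> (y - x') - r \<bullet> (y - x) + r \<bullet> (x' - x)) / 4"
    unfolding q power2_norm_eq_inner
    by (simp add: inner_add_left inner_diff_left inner_diff_right)
  finally have expand: "?u' y = ?u y - ?u x' + (x' - x) \<bullet> (y - x) - (norm (x' - x))\<^sup>2
      + (r' \<bullet> (y - x') - r \<bullet> (y - x) + r \<bullet> (x' - x)) / 4"
    by simp
  have u'y: "?u' y \<le> 3 * (\<epsilon>\<^sup>2 + ?u y + (norm (y - x))\<^sup>2)"
  proof -
    have "r' \<bullet> (y - x') \<le> \<epsilon>\<^sup>2 + ?u' y + (norm (y - x'))\<^sup>2"
      "- (r \<bullet> (y - x)) \<le> \<epsilon>\<^sup>2 + ?u y + (norm (y - x))\<^sup>2"
      "r \<bullet> (x' - x) \<le> \<epsilon>\<^sup>2 + ?u x' + (norm (x' - x))\<^sup>2"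
      using dual_cellD[OF r' y] dual_cellD[OF r y] dual_cellD[OF r x'] by (auto simp: abs_le_iff)
    then show ?thesis
      using expand gap(1)[OF y] gap(1)[OF x'] gap(2)[OF x] young[of "x' - x" "y - x"] sq near(2) near_y
        zero_le_power2[of "norm (x' - x)"] zero_le_power2[of "norm (y - x)"] zero_le_power2[of \<epsilon>]
      by argo
  qed
  have "(p' - p) \<bullet> (y - x) = affine_gap f x p y - affine_gap f x' p' y + affine_gap f x' p' x"
    by (simp add: affine_gap_def inner_diff_left inner_diff_right)
  then have "\<bar>(p' - p) \<bullet> (y - x)\<bar> \<le> ?u y + ?u' y + ?u' x"
    using c[OF y] c'[OF y] c'[OF x] by linarith
  also have "\<dots> \<le> 4 * (\<epsilon>\<^sup>2 + ?u y + (norm (y - x))\<^sup>2)"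
    using u'y near(2) gap(1)[OF x'] gap(1)[OF y] zero_le_power2[of "norm (y - x)"] by argo
  finally show ?thesis .
qed

lemma closed_dual_cell: "closed (dual_cell W \<phi> \<epsilon> x q)"
proof -
  have "dual_cell W \<phi> \<epsilon> x q =
      (\<Inter>y\<in>W. {r. \<bar>r \<bullet> (y - x)\<bar> \<le> \<epsilon>\<^sup>2 + affine_gap \<phi> x q y + (norm (y - x))\<^sup>2})"
    by (auto simp: dual_cell_def)
  then show ?thesis
    by (auto intro!: closed_Collect_le continuous_intros)
qed

text \<open>This keeps the cells at a definite size and makes room for the thickness of the tube: a displacement
  of at most \<open>2 * \<epsilon>\<close> in the covector stays in the dual body, because
  \<open>2 \<epsilon> t \<le> \<epsilon>\<^sup>2 + t\<^sup>2\<close>.\<close>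

lemma cball_subset_dual_cell:
  fixes \<phi> :: "'a::real_inner \<Rightarrow> real"
  assumes gap: "\<And>y. y \<in> W \<Longrightarrow> 0 \<le> affine_gap \<phi> x q y" and \<epsilon>: "0 \<le> \<epsilon>"
  shows "cball 0 (2 * \<epsilon>) \<subseteq> dual_cell W \<phi> \<epsilon> x q"
proof (clarsimp simp: dual_cell_def)
  fix r y :: 'a assume r: "norm r \<le> 2 * \<epsilon>" and y: "y \<in> W"
  have "\<bar>r \<bullet> (y - x)\<bar> \<le> 2 * \<epsilon> * norm (y - x)"
    using Cauchy_Schwarz_ineq2[of r "y - x"] mult_right_mono[OF r norm_ge_zero[of "y - x"]] by linarith
  also have "\<dots> \<le> \<epsilon>\<^sup>2 + (norm (y - x))\<^sup>2"
    by (rule sum_squares_bound)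
  finally show "\<bar>r \<bullet> (y - x)\<bar> \<le> \<epsilon>\<^sup>2 + affine_gap \<phi> x q y + (norm (y - x))\<^sup>2"
    using gap[OF y] by simp
qed

lemma dual_cell_norm_bound:
  fixes \<phi> :: "'a::real_inner \<Rightarrow> real"
  assumes gap: "\<And>y. y \<in> ball a (2 * \<rho>) \<Longrightarrow> 0 \<le> affine_gap \<phi> x q y"
    and M: "\<And>y. y \<in> ball a (2 * \<rho>) \<Longrightarrow> \<bar>\<phi> y\<bar> \<le> M"
    and x: "x \<in> cball a \<rho>" and \<rho>: "0 < \<rho>" and \<epsilon>: "0 \<le> \<epsilon>" "\<epsilon> \<le> 1"
    and r: "r \<in> dual_cell (ball a (2 * \<rho>)) \<phi> \<epsilon> x q"
  shows "norm r \<le> 2 / \<rho> * (1 + 4 * M + \<rho>\<^sup>2)"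
proof (cases "r = 0")
  case True
  have "0 \<le> M" using M[of a] \<rho> by fastforce
  then show ?thesis using True \<rho> by simp
next
  case False
  let ?y = "x + (\<rho> / (2 * norm r)) *\<^sub>R r"
  have d: "dist x ?y = \<rho> / 2" using False \<rho> by (simp add: dist_norm)
  have y: "?y \<in> ball a (2 * \<rho>)"
    using x d dist_triangle[of a ?y x] \<rho> unfolding mem_ball mem_cball by linarith
  have x2: "x \<in> ball a (2 * \<rho>)" and x3: "x \<in> ball a (3 / 2 * \<rho>)" using x \<rho> by auto
  have n: "norm (?y - x) = \<rho> / 2" using d by (simp add: dist_norm norm_minus_commute)
  have "\<bar>q \<bullet> (?y - x)\<bar> \<le> norm q * (\<rho> / 2)"
    using Cauchy_Schwarz_ineq2[of q "?y - x"] unfolding n .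
  also have "\<dots> \<le> 4 * M / \<rho> * (\<rho> / 2)"
    using subgradient_norm_bound[OF gap M x3 \<rho>] \<rho> by (intro mult_right_mono) auto
  also have "\<dots> = 2 * M" using \<rho> by simp
  finally have "affine_gap \<phi> x q ?y \<le> 4 * M"
    using M[OF y] M[OF x2] unfolding affine_gap_def by linarith
  moreover have "\<epsilon>\<^sup>2 \<le> 1" using \<epsilon> by (simp add: power_le_one)
  moreover have "r \<bullet> (?y - x) = \<rho> / 2 * norm r"
    using False by (simp add: dot_square_norm power2_eq_square)
  moreover have "(norm (?y - x))\<^sup>2 \<le> \<rho>\<^sup>2"
    unfolding n using \<rho> by (intro power_mono) auto
  ultimately have "\<rho> / 2 * norm r \<le> 1 + 4 * M + \<rho>\<^sup>2"
    using dual_cellD[OF r y] by linarith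
  then show ?thesis using \<rho> by (simp add: field_simps)
qed

section \<open>Disjoint cells of definite size\<close>

lemma emeasure_lebesgue_ball:
  fixes c :: "'a::euclidean_space"
  assumes "0 \<le> r"
  shows "emeasure lebesgue (ball c r) = ennreal (unit_ball_vol (DIM('a)) * r ^ DIM('a))"
    and "emeasure lebesgue (cball c r) = ennreal (unit_ball_vol (DIM('a)) * r ^ DIM('a))"
  using emeasure_ball[OF assms, of c] emeasure_cball[OF assms, of c] by (simp_all add: main_part_sets)

text \<open>Each set takes up at least the volume of a ball of radius \<open>\<delta>\<close>, so the cardinality of a disjoint
  subfamily is bounded, and one of largest cardinality cannot be enlarged.\<close>

lemma maximal_disjoint_subfamily:
  fixes R :: "'i \<Rightarrow> 'a::euclidean_space set"
  assumes \<delta>: "0 < \<delta>" and V: "0 \<le> V"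
    and meas: "\<And>i. i \<in> I \<Longrightarrow> R i \<in> sets lebesgue"
    and inner: "\<And>i. i \<in> I \<Longrightarrow> ball (c i) \<delta> \<subseteq> R i"
    and outer: "\<And>i. i \<in> I \<Longrightarrow> R i \<subseteq> cball 0 V"
  shows "\<exists>J. finite J \<and> J \<subseteq> I \<and> disjoint_family_on R J \<and> (\<forall>i\<in>I. \<exists>j\<in>J. R i \<inter> R j \<noteq> {})"
proof -
  let ?v = "unit_ball_vol (DIM('a))"
  define P where "P n \<longleftrightarrow> (\<exists>J\<subseteq>I. finite J \<and> disjoint_family_on R J \<and> card J = n)" for n
  have bound: "n \<le> nat \<lceil>V ^ DIM('a) / \<delta> ^ DIM('a)\<rceil>" if n: "P n" for n
  proof -
    obtain J where J: "J \<subseteq> I" "finite J" "disjoint_family_on R J" "card J = n"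
      using n unfolding P_def by blast
    have "ennreal (real n * (?v * \<delta> ^ DIM('a))) = (\<Sum>j\<in>J. emeasure lebesgue (ball (c j) \<delta>))"
      using \<delta> J by (simp only: emeasure_lebesgue_ball(1)[OF less_imp_le[OF \<delta>]] sum_constant)
        (simp add: ennreal_mult ennreal_of_nat_eq_real_of_nat)
    also have "\<dots> \<le> (\<Sum>j\<in>J. emeasure lebesgue (R j))"
      using J inner meas by (intro sum_mono emeasure_mono) auto
    also have "\<dots> = emeasure lebesgue (\<Union>j\<in>J. R j)"
      using J meas by (intro sum_emeasure) auto
    also have "\<dots> \<le> emeasure lebesgue (cball (0::'a) V)"
      using J outer by (intro emeasure_mono) auto
    also have "\<dots> = ennreal (?v * V ^ DIM('a))"
      by (rule emeasure_lebesgue_ball(2)[OF V])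
    finally have "real n * (?v * \<delta> ^ DIM('a)) \<le> ?v * V ^ DIM('a)"
      using V by (simp add: ennreal_le_iff)
    moreover have "0 < ?v" by simp
    ultimately have "real n * \<delta> ^ DIM('a) \<le> V ^ DIM('a)"
      by (metis mult.left_commute mult_le_cancel_left_pos)
    then have "real n \<le> V ^ DIM('a) / \<delta> ^ DIM('a)"
      using \<delta> by (simp add: field_simps)
    then show ?thesis by linarith
  qed
  have "P 0" unfolding P_def by (intro exI[of _ "{}"]) (simp add: disjoint_family_on_def)
  then obtain n where "P n" and max: "\<And>m. P m \<Longrightarrow> m \<le> n"
    using Nat.ex_has_greatest_nat[of P 0 "nat \<lceil>V ^ DIM('a) / \<delta> ^ DIM('a)\<rceil>"] bound by auto
  then obtain J where J: "J \<subseteq> I" "finite J" "disjoint_family_on R J" "card J = n"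
    unfolding P_def by blast
  show ?thesis
  proof (intro exI[of _ J] conjI J(1-3) ballI)
    fix i assume i: "i \<in> I"
    show "\<exists>j\<in>J. R i \<inter> R j \<noteq> {}"
    proof (rule ccontr)
      assume none: "\<not> ?thesis"
      have "c i \<in> R i" using inner[OF i] \<delta> by auto
      then have "i \<notin> J" using none by blast
      have "disjoint_family_on R (insert i J)"
        using J(3) none unfolding disjoint_family_on_def by blast
      then have "P (Suc n)"
        unfolding P_def using J i \<open>i \<notin> J\<close> by (intro exI[of _ "insert i J"]) simp
      then show False using max by fastforce
    qed
  qed
qed

section \<open>The volume of the tube\<close>

lemma emeasure_lebesgue_Times:
  fixes A :: "'a::euclidean_space set" and B :: "'b::euclidean_space set"
  assumes "A \<in> sets borel" "B \<in> sets borel"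
  shows "emeasure lebesgue (A \<times> B) = emeasure lebesgue A * emeasure lebesgue B"
proof -
  have "A \<times> B \<in> sets borel"
    using assms by (simp add: borel_prod[symmetric])
  then have "emeasure lebesgue (A \<times> B) = emeasure (lborel \<Otimes>\<^sub>M lborel) (A \<times> B)"
    by (simp add: lborel_prod)
  also have "\<dots> = emeasure lborel A * emeasure lborel B"
    using assms by (intro lborel.emeasure_pair_measure_Times) auto
  finally show ?thesis using assms by simp
qed

text \<open>The cell at \<open>x + q\<close> is a copy of the dual body at scale \<open>1 / 4\<close>, and the cover of the tube
  uses it at scale \<open>5\<close>; hence the dilation by \<open>20\<close>.\<close>

lemma dual_cell_image_of_minty_cell:
  "(\<lambda>w. 20 *\<^sub>R w + (p - 20 *\<^sub>R (x + q))) ` minty_cell W \<phi> \<epsilon> x q = (\<lambda>r. 5 *\<^sub>R r + p) ` dual_cell W \<phi> \<epsilon> x q"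
  unfolding minty_cell_def image_image by (rule image_cong) (auto simp: algebra_simps)

text \<open>The radius is \<open>2 * \<epsilon>\<close> since a point at infimal distance at most \<open>\<epsilon>\<close> need not
  have a point of the set at distance \<open>\<epsilon>\<close>; open balls make the tube of a union the union of the tubes.\<close>

definition tubes_of_order :: "nat \<Rightarrow> 'a::euclidean_space set \<Rightarrow> bool" where
  "tubes_of_order k T \<longleftrightarrow> (\<exists>C. \<forall>\<epsilon>. 0 < \<epsilon> \<longrightarrow> \<epsilon> \<le> 1 \<longrightarrow>
     emeasure lebesgue (\<Union>s\<in>T. ball s (2 * \<epsilon>)) \<le> ennreal (C * \<epsilon> ^ k))"

text \<open>The chosen cells are disjoint inside a ball whose radius \<open>V\<close> does not depend on \<open>\<epsilon>\<close>; the constant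
  depends only on \<open>V\<close> and the dimension.\<close>

lemma controlled_slopes_tube_bound:
  fixes S :: "('a::euclidean_space \<times> 'a) set" and \<phi> f :: "'a \<Rightarrow> real"
  assumes \<rho>: "0 < \<rho>"
    and M: "\<And>y. y \<in> ball a (2 * \<rho>) \<Longrightarrow> \<bar>\<phi> y\<bar> \<le> M"
    and S: "\<And>x p. (x, p) \<in> S \<Longrightarrow> x \<in> cball a \<rho>"
    and ctrl: "\<And>x p. (x, p) \<in> S \<Longrightarrow>
      \<exists>q. \<forall>y\<in>ball a (2 * \<rho>). \<bar>affine_gap f x p y\<bar> \<le> affine_gap \<phi> x q y"
  shows "tubes_of_order DIM('a) S"
proof -
  let ?W = "ball a (2 * \<rho>)" and ?u = "unit_ball_vol (DIM('a))" and ?d = "DIM('a)"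
  from ctrl have "\<exists>q. \<forall>y\<in>?W. \<bar>affine_gap f (fst s) (snd s) y\<bar> \<le> affine_gap \<phi> (fst s) q y" if "s \<in> S" for s
    using that by (metis prod.collapse)
  then obtain Q where Q: "\<And>s y. s \<in> S \<Longrightarrow> y \<in> ?W \<Longrightarrow>
      \<bar>affine_gap f (fst s) (snd s) y\<bar> \<le> affine_gap \<phi> (fst s) (Q s) y"
    by metis
  have gap: "0 \<le> affine_gap \<phi> (fst s) (Q s) y" if "s \<in> S" "y \<in> ?W" for s y
    using Q[OF that] by linarith
  have base: "fst s \<in> cball a \<rho>" if "s \<in> S" for s
    using S[of "fst s" "snd s"] that by simp
  have baseW: "fst s \<in> ?W" if "s \<in> S" for s
    using base[OF that] \<rho> by simp
  define L where "L = 2 / \<rho> * (1 + 4 * M + \<rho>\<^sup>2)"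
  define V where "V = L + (norm a + \<rho>) + 4 * M / \<rho>"
  have "0 \<le> M" using M[of a] \<rho> by fastforce
  then have "0 \<le> L" "0 \<le> V" using \<rho> by (simp_all add: L_def V_def)
  show ?thesis
    unfolding tubes_of_order_def
  proof (intro exI allI impI)
    fix \<epsilon> :: real assume \<epsilon>: "0 < \<epsilon>" "\<epsilon> \<le> 1"
    define D where "D s = dual_cell ?W \<phi> \<epsilon> (fst s) (Q s)" for s
    define R where "R s = minty_cell ?W \<phi> \<epsilon> (fst s) (Q s)" for s
    define E where "E s = (\<lambda>r. 5 *\<^sub>R r + snd s) ` D s" for s :: "'a \<times> 'a"
    have R_eq: "R s = (\<lambda>r. (1 / 4) *\<^sub>R r + (fst s + Q s)) ` D s" for s
      by (simp add: R_def D_def minty_cell_def)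
    have E_eq: "E s = (\<lambda>w. 20 *\<^sub>R w + (snd s - 20 *\<^sub>R (fst s + Q s))) ` R s" for s
      unfolding E_def R_def D_def by (rule dual_cell_image_of_minty_cell[symmetric])
    have D_bound: "norm r \<le> L" if "s \<in> S" "r \<in> D s" for r s
      unfolding L_def
    proof (rule dual_cell_norm_bound)
      show "r \<in> dual_cell ?W \<phi> \<epsilon> (fst s) (Q s)" using that by (simp add: D_def)
    qed (use gap M base \<rho> \<epsilon> that in auto)
    have D_ball: "cball 0 (2 * \<epsilon>) \<subseteq> D s" if "s \<in> S" for s
      unfolding D_def using gap[OF that] \<epsilon> by (intro cball_subset_dual_cell) auto
    have cD: "compact (D s)" if "s \<in> S" for s
      unfolding compact_eq_bounded_closed
      using D_bound[OF that] closed_dual_cell by (auto simp: bounded_iff D_def)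
    have cR: "compact (R s)" and cE: "compact (E s)" if "s \<in> S" for s
      unfolding R_eq E_def using cD[OF that]
      by (auto intro!: compact_continuous_image continuous_intros)
    have mE: "E s \<in> sets borel" if "s \<in> S" for s
      using cE[OF that] by (rule borel_compact)
    have mR: "R s \<in> sets lebesgue" if "s \<in> S" for s
      using borel_compact[OF cR[OF that]] by simp
    have R_ball: "ball (fst s + Q s) (\<epsilon> / 2) \<subseteq> R s" if "s \<in> S" for s
    proof
      fix w assume w: "w \<in> ball (fst s + Q s) (\<epsilon> / 2)"
      have "4 *\<^sub>R (w - (fst s + Q s)) \<in> D s"
        using w by (intro subsetD[OF D_ball[OF that]]) (simp add: dist_norm norm_minus_commute)
      then show "w \<in> R s"
        unfolding R_eq by (intro image_eqI[where x = "4 *\<^sub>R (w - (fst s + Q s))"]) auto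
    qed
    have R_outer: "R s \<subseteq> cball 0 V" if s: "s \<in> S" for s
    proof
      fix w assume "w \<in> R s"
      then obtain r where r: "r \<in> D s" and w: "w = (1 / 4) *\<^sub>R r + (fst s + Q s)"
        unfolding R_eq by blast
      have "norm (fst s) \<le> norm a + \<rho>"
        using base[OF s] norm_triangle_sub[of "fst s" a] by (simp add: dist_norm norm_minus_commute)
      moreover have "norm (Q s) \<le> 4 * M / \<rho>"
        using base[OF s] \<rho> by (intro subgradient_norm_bound[where a = a and \<phi> = \<phi> and x = "fst s"] gap[OF s] M) auto
      moreover have "norm ((1 / 4) *\<^sub>R r) \<le> L"
        using D_bound[OF s r] \<open>0 \<le> L\<close> by simp
      moreover have "norm w \<le> norm ((1 / 4) *\<^sub>R r) + (norm (fst s) + norm (Q s))"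
        unfolding w by (intro norm_triangle_le add_left_mono norm_triangle_ineq)
      ultimately have "norm w \<le> V" unfolding V_def by linarith
      then show "w \<in> cball 0 V" by simp
    qed
    have "\<exists>J. finite J \<and> J \<subseteq> S \<and> disjoint_family_on R J \<and> (\<forall>s\<in>S. \<exists>j\<in>J. R s \<inter> R j \<noteq> {})"
      by (rule maximal_disjoint_subfamily[where c = "\<lambda>s. fst s + Q s",
            OF half_gt_zero[OF \<epsilon>(1)] \<open>0 \<le> V\<close> mR R_ball R_outer])
    then obtain J where J: "finite J" "J \<subseteq> S" "disjoint_family_on R J"
      and meets: "\<And>s. s \<in> S \<Longrightarrow> \<exists>j\<in>J. R s \<inter> R j \<noteq> {}"
      by blast
    \<comment> \<open>A point of the tube is near some \<open>s\<close>, whose cell meets a chosen cell \<open>j\<close>: the slopes of \<open>s\<close> and \<open>j\<close>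
      differ by an element of \<open>4 D\<close>, and the thickness of the tube adds one more copy of \<open>D\<close>.\<close>
    have cover: "(\<Union>s\<in>S. ball s (2 * \<epsilon>)) \<subseteq> (\<Union>j\<in>J. cball (fst j) (3 * \<epsilon>) \<times> E j)"
    proof
      fix z assume "z \<in> (\<Union>s\<in>S. ball s (2 * \<epsilon>))"
      then obtain s where s: "s \<in> S" and z: "dist s z < 2 * \<epsilon>" by auto
      obtain j where j: "j \<in> J" and "R s \<inter> R j \<noteq> {}" using meets[OF s] by blast
      have jS: "j \<in> S" using j J by blast
      obtain r r' where r: "r \<in> D j" "r' \<in> D s"
        and eq: "(1 / 4) *\<^sub>R r + (fst j + Q j) = (1 / 4) *\<^sub>R r' + (fst s + Q s)"
        using \<open>R s \<inter> R j \<noteq> {}\<close> unfolding R_eq by fastforce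
      note near = minty_cells_meet_imp_near[OF baseW[OF jS] baseW[OF s] less_imp_le[OF \<epsilon>(1)]
          gap[OF jS baseW[OF s]] gap[OF s baseW[OF jS]] r[unfolded D_def] eq]
      have zf: "dist (fst s) (fst z) \<le> 2 * \<epsilon>" and zs: "dist (snd s) (snd z) \<le> 2 * \<epsilon>"
        using z dist_fst_le[of s z] dist_snd_le[of s z] by linarith+
      have "dist (fst j) (fst z) \<le> 3 * \<epsilon>"
        using near(1) zf dist_triangle[of "fst j" "fst z" "fst s"]
        by (simp add: dist_norm norm_minus_commute)
      moreover have "(1 / 5) *\<^sub>R (snd z - snd j) \<in> D j"
        unfolding D_def dual_cell_def
      proof (rule CollectI, rule ballI)
        fix y assume y: "y \<in> ?W"
        let ?b = "\<epsilon>\<^sup>2 + affine_gap \<phi> (fst j) (Q j) y + (norm (y - fst j))\<^sup>2"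
        have "\<bar>(snd s - snd j) \<bullet> (y - fst j)\<bar> \<le> 4 * ?b"
          using minty_cells_meet_imp_slopes_near[OF baseW[OF jS] baseW[OF s] less_imp_le[OF \<epsilon>(1)]
              Q[OF jS] Q[OF s] r[unfolded D_def] eq y] by blast
        moreover have "snd z - snd s \<in> D j"
          using zs by (intro subsetD[OF D_ball[OF jS]]) (simp add: dist_norm norm_minus_commute)
        then have "\<bar>(snd z - snd s) \<bullet> (y - fst j)\<bar> \<le> ?b"
          unfolding D_def by (rule dual_cellD[OF _ y])
        moreover have "(snd z - snd j) \<bullet> (y - fst j)
            = (snd z - snd s) \<bullet> (y - fst j) + (snd s - snd j) \<bullet> (y - fst j)"
          by (simp add: inner_diff_left)
        moreover have "\<bar>w\<bar> / 5 \<le> b" if "\<bar>u\<bar> \<le> 4 * b" "\<bar>v\<bar> \<le> b" "w = v + u" for u v w b :: real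
          using that by linarith
        ultimately have "\<bar>(snd z - snd j) \<bullet> (y - fst j)\<bar> / 5 \<le> ?b"
          by blast
        then show "\<bar>(1 / 5) *\<^sub>R (snd z - snd j) \<bullet> (y - fst j)\<bar> \<le> ?b"
          by (simp add: abs_mult)
      qed
      then have "snd z \<in> E j"
        unfolding E_def by (intro image_eqI[where x = "(1 / 5) *\<^sub>R (snd z - snd j)"]) auto
      ultimately have "z \<in> cball (fst j) (3 * \<epsilon>) \<times> E j"
        by (simp add: mem_Times_iff)
      then show "z \<in> (\<Union>j\<in>J. cball (fst j) (3 * \<epsilon>) \<times> E j)" using j by blast
    qed
    \<comment> \<open>Each piece of the cover costs \<open>\<epsilon>\<^sup>d\<close> times the volume of its cell.\<close>
    have piece: "emeasure lebesgue (cball (fst j) (3 * \<epsilon>) \<times> E j)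
        = ennreal (?u * (3 * \<epsilon>) ^ ?d * 20 ^ ?d) * emeasure lebesgue (R j)" if "j \<in> J" for j
    proof -
      have "emeasure lebesgue (cball (fst j) (3 * \<epsilon>) \<times> E j)
          = emeasure lebesgue (cball (fst j) (3 * \<epsilon>)) * emeasure lebesgue (E j)"
        using mE[OF subsetD[OF J(2) that]] by (intro emeasure_lebesgue_Times) simp_all
      also have "emeasure lebesgue (cball (fst j) (3 * \<epsilon>)) = ennreal (?u * (3 * \<epsilon>) ^ ?d)"
        using \<epsilon> by (intro emeasure_lebesgue_ball(2)) simp
      also have "emeasure lebesgue (E j) = ennreal (20 ^ ?d) * emeasure lebesgue (R j)"
        unfolding E_eq by (subst emeasure_lebesgue_affine) simp
      finally show ?thesis using \<epsilon> by (simp add: ennreal_mult mult.assoc)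
    qed
    have mP: "(\<lambda>j. cball (fst j) (3 * \<epsilon>) \<times> E j) ` J \<subseteq> sets lebesgue"
    proof (rule image_subsetI)
      fix j assume "j \<in> J"
      then have "compact (cball (fst j) (3 * \<epsilon>) \<times> E j)"
        using cE J(2) by (intro compact_Times compact_cball) blast
      then show "cball (fst j) (3 * \<epsilon>) \<times> E j \<in> sets lebesgue"
        by (intro sets_completionI_sets) (simp add: borel_compact)
    qed
    have "emeasure lebesgue (\<Union>s\<in>S. ball s (2 * \<epsilon>))
        \<le> emeasure lebesgue (\<Union>j\<in>J. cball (fst j) (3 * \<epsilon>) \<times> E j)"
      using cover mP J by (intro emeasure_mono sets.finite_UN) auto
    also have "\<dots> \<le> (\<Sum>j\<in>J. emeasure lebesgue (cball (fst j) (3 * \<epsilon>) \<times> E j))"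
      using J mP by (intro emeasure_subadditive_finite) auto
    also have "\<dots> = ennreal (?u * (3 * \<epsilon>) ^ ?d * 20 ^ ?d) * (\<Sum>j\<in>J. emeasure lebesgue (R j))"
      by (simp add: piece sum_distrib_left)
    also have "(\<Sum>j\<in>J. emeasure lebesgue (R j)) = emeasure lebesgue (\<Union>j\<in>J. R j)"
      using J mR by (intro sum_emeasure) auto
    also have "\<dots> \<le> emeasure lebesgue (cball (0::'a) V)"
      using J R_outer by (intro emeasure_mono) auto
    also have "\<dots> = ennreal (?u * V ^ ?d)"
      using \<open>0 \<le> V\<close> by (rule emeasure_lebesgue_ball(2))
    also have "ennreal (?u * (3 * \<epsilon>) ^ ?d * 20 ^ ?d) * ennreal (?u * V ^ ?d)
        = ennreal ((?u * 3 ^ ?d * 20 ^ ?d * (?u * V ^ ?d)) * \<epsilon> ^ ?d)"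
      using \<epsilon> \<open>0 \<le> V\<close> by (subst ennreal_mult[symmetric]) (auto simp: power_mult_distrib mult_ac)
    finally show "emeasure lebesgue (\<Union>s\<in>S. ball s (2 * \<epsilon>))
        \<le> ennreal ((?u * 3 ^ ?d * 20 ^ ?d * (?u * V ^ ?d)) * \<epsilon> ^ ?d)"
      by (simp add: mult_left_mono)
  qed
qed

lemma tube_subset_Union_balls:
  assumes "0 < \<epsilon>"
  shows "tube S \<epsilon> \<subseteq> (\<Union>s\<in>S. ball s (2 * \<epsilon>))"
proof
  fix z assume "z \<in> tube S \<epsilon>"
  then have "S \<noteq> {}" "infdist z S < 2 * \<epsilon>" using assms by (auto simp: tube_def)
  then obtain s where "s \<in> S" "dist z s < 2 * \<epsilon>"
    by (auto simp: infdist_notempty cINF_less_iff)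
  then show "z \<in> (\<Union>s\<in>S. ball s (2 * \<epsilon>))" by (auto simp: dist_commute)
qed

text \<open>Codimension \<open>DIM('a) - m\<close> in the volume is dimension \<open>m\<close> in the content: the power of
  \<open>2 * \<epsilon>\<close> in the content cancels \<open>\<epsilon> ^ (DIM('a) - m)\<close>.\<close>

lemma finite_content_of_tube_cover:
  fixes S :: "'a::euclidean_space set"
  assumes "finite I" and cover: "S \<subseteq> (\<Union>i\<in>I. T i)" and m: "m \<le> DIM('a)"
    and T: "\<And>i. i \<in> I \<Longrightarrow> tubes_of_order (DIM('a) - m) (T i)"
  shows "finite_content m S"
proof -
  let ?k = "DIM('a) - m"
  obtain C where C: "\<And>i \<epsilon>. i \<in> I \<Longrightarrow> 0 < \<epsilon> \<Longrightarrow> \<epsilon> \<le> 1 \<Longrightarrow>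
       emeasure lebesgue (\<Union>s\<in>T i. ball s (2 * \<epsilon>)) \<le> ennreal (C i * \<epsilon> ^ ?k)"
    using T unfolding tubes_of_order_def by metis
  define B where "B = (\<Sum>i\<in>I. ennreal (C i))"
  have "ennreal ((2 * \<epsilon>) powr (real m - real DIM('a))) * emeasure lebesgue (tube S \<epsilon>) \<le> B"
    if \<epsilon>: "0 < \<epsilon>" "\<epsilon> < 1" for \<epsilon>
  proof -
    have "tube S \<epsilon> \<subseteq> (\<Union>i\<in>I. \<Union>s\<in>T i. ball s (2 * \<epsilon>))"
      using tube_subset_Union_balls[OF \<epsilon>(1), of S] cover by blast
    moreover have "open (\<Union>i\<in>I. \<Union>s\<in>T i. ball s (2 * \<epsilon>))" by auto
    ultimately have "emeasure lebesgue (tube S \<epsilon>) \<le> emeasure lebesgue (\<Union>i\<in>I. \<Union>s\<in>T i. ball s (2 * \<epsilon>))"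
      by (intro emeasure_mono sets_completionI_sets) (simp_all add: borel_open)
    also have "\<dots> \<le> (\<Sum>i\<in>I. emeasure lebesgue (\<Union>s\<in>T i. ball s (2 * \<epsilon>)))"
      using \<open>finite I\<close> by (intro emeasure_subadditive_finite) (auto intro!: sets_completionI_sets borel_open open_UN)
    also have "\<dots> \<le> (\<Sum>i\<in>I. ennreal (C i * \<epsilon> ^ ?k))"
      using C \<epsilon> by (intro sum_mono) auto
    also have "\<dots> = B * ennreal (\<epsilon> ^ ?k)"
      using \<epsilon> by (simp add: B_def sum_distrib_right ennreal_mult'')
    finally have le: "emeasure lebesgue (tube S \<epsilon>) \<le> B * ennreal (\<epsilon> ^ ?k)" .
    have "(2 * \<epsilon>) powr (real m - real DIM('a)) * \<epsilon> ^ ?k = (\<epsilon> / (2 * \<epsilon>)) ^ ?k"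
    proof -
      have "real m - real DIM('a) = - real ?k" using m by simp
      then have "(2 * \<epsilon>) powr (real m - real DIM('a)) = inverse ((2 * \<epsilon>) ^ ?k)"
        using \<epsilon> by (simp only: powr_minus powr_realpow mult_pos_pos zero_less_numeral)
      then have "(2 * \<epsilon>) powr (real m - real DIM('a)) * \<epsilon> ^ ?k = \<epsilon> ^ ?k / (2 * \<epsilon>) ^ ?k"
        by (simp only: divide_inverse mult.commute)
      then show ?thesis
        by (simp only: power_divide)
    qed
    also have "\<dots> \<le> 1" using \<epsilon> by (intro power_le_one) auto
    finally have "(2 * \<epsilon>) powr (real m - real DIM('a)) * \<epsilon> ^ ?k \<le> 1" .
    then have one: "ennreal ((2 * \<epsilon>) powr (real m - real DIM('a))) * ennreal (\<epsilon> ^ ?k) \<le> 1"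
      using \<epsilon> by (simp flip: ennreal_mult)
    have "ennreal ((2 * \<epsilon>) powr (real m - real DIM('a))) * emeasure lebesgue (tube S \<epsilon>)
        \<le> ennreal ((2 * \<epsilon>) powr (real m - real DIM('a))) * (B * ennreal (\<epsilon> ^ ?k))"
      using le by (rule mult_left_mono) simp
    also have "\<dots> = B * (ennreal ((2 * \<epsilon>) powr (real m - real DIM('a))) * ennreal (\<epsilon> ^ ?k))"
      by (simp add: mult_ac)
    also have "\<dots> \<le> B * 1" using one by (rule mult_left_mono) simp
    finally show ?thesis by simp
  qed
  then have "upper_content m S \<le> B"
    unfolding upper_content_def
    by (intro Limsup_bounded) (auto simp: eventually_at_right_field intro!: exI[of _ 1])
  also have "B < \<infinity>" using \<open>finite I\<close> by (simp add: B_def less_top)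
  finally show ?thesis unfolding finite_content_def .
qed

section \<open>Local finiteness of the content\<close>

text \<open>A compact ball inside the neighborhood on which \<open>f = g - h\<close> provides the bound on \<open>\<phi> = g + h\<close>;
  half of its radius is kept as margin for testing subgradients.\<close>

lemma DC_locally_controlled:
  fixes f :: "'a::euclidean_space \<Rightarrow> real"
  assumes "DC f"
  obtains \<rho> M \<phi> where "0 < \<rho>" "\<And>y. y \<in> ball a (2 * \<rho>) \<Longrightarrow> \<bar>\<phi> y\<bar> \<le> M"
    "\<And>x p. x \<in> cball a \<rho> \<Longrightarrow> p \<in> clarke_diff f x \<Longrightarrow>
       \<exists>q. \<forall>y\<in>ball a (2 * \<rho>). \<bar>affine_gap f x p y\<bar> \<le> affine_gap \<phi> x q y"
proof -
  obtain U g h where U: "a \<in> interior U" "convex_on U g" "convex_on U h" "\<And>y. y \<in> U \<Longrightarrow> f y = g y - h y"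
    using assms unfolding DC_def by metis
  obtain r where r: "0 < r" "cball a r \<subseteq> interior U"
    using U(1) open_contains_cball[of "interior U"] by auto
  let ?\<phi> = "\<lambda>y. g y + h y"
  have sub: "interior U \<subseteq> U" by (rule interior_subset)
  have cI: "convex (interior U)" using U(2) convex_on_imp_convex convex_interior by blast
  have "continuous_on (interior U) g" "continuous_on (interior U) h"
    using U(2,3) cI sub by (auto intro!: convex_on_continuous intro: convex_on_subset)
  then have "continuous_on (cball a r) ?\<phi>"
    using r(2) by (intro continuous_intros) (auto intro: continuous_on_subset)
  then have "bounded (?\<phi> ` cball a r)"
    by (intro compact_imp_bounded compact_continuous_image) auto
  then obtain M where M: "\<And>y. y \<in> cball a r \<Longrightarrow> \<bar>?\<phi> y\<bar> \<le> M"
    unfolding bounded_iff by fastforce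
  define \<rho> where "\<rho> = r / 2"
  have \<rho>: "0 < \<rho>" using r by (simp add: \<rho>_def)
  have ballr: "ball a (2 * \<rho>) \<subseteq> cball a r"
    using ball_subset_cball[of a r] by (simp add: \<rho>_def)
  have ballU: "ball a (2 * \<rho>) \<subseteq> U"
    using ballr r(2) sub by blast
  have gh: "convex_on (ball a (2 * \<rho>)) g" "convex_on (ball a (2 * \<rho>)) h"
    using U(2,3) ballU by (auto intro: convex_on_subset)
  show thesis
  proof (rule that[of \<rho> ?\<phi> M])
    show "0 < \<rho>" by (rule \<rho>)
    show bd: "\<bar>?\<phi> y\<bar> \<le> M" if "y \<in> ball a (2 * \<rho>)" for y
      using M ballr that by blast
    fix x p assume x: "x \<in> cball a \<rho>" and p: "p \<in> clarke_diff f x"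
    show "\<exists>q. \<forall>y\<in>ball a (2 * \<rho>). \<bar>affine_gap f x p y\<bar> \<le> affine_gap ?\<phi> x q y"
      using gh _ bd \<rho> x p
    proof (rule clarke_diff_control)
      show "\<And>y. y \<in> ball a (2 * \<rho>) \<Longrightarrow> f y = g y - h y" using U(4) ballU by blast
    qed
  qed
qed

text \<open>The projection of the compact set to the base is covered by finitely many balls on which \<open>f\<close> is
  controlled; over each of them the whole graph has tubes of the right order, as the bound on \<open>x\<close>
  already bounds the covectors.\<close>

theorem clarke_graph_locally_finite_content:
  fixes f :: "'a::euclidean_space \<Rightarrow> real"
  assumes "DC f"
  shows "locally_finite_content DIM('a) (clarke_graph f)"
  unfolding locally_finite_content_def
proof (intro allI impI)
  fix K :: "('a \<times> 'a) set" assume "compact K"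
  let ?T = "\<lambda>a \<rho>. {(x, p). x \<in> cball a \<rho> \<and> p \<in> clarke_diff f x}"
  have "\<exists>\<rho>>0. tubes_of_order DIM('a) (?T a \<rho>)" for a
  proof -
    obtain \<rho> M \<phi> where *: "0 < \<rho>" "\<And>y. y \<in> ball a (2 * \<rho>) \<Longrightarrow> \<bar>\<phi> y\<bar> \<le> M"
      "\<And>x p. x \<in> cball a \<rho> \<Longrightarrow> p \<in> clarke_diff f x \<Longrightarrow>
         \<exists>q. \<forall>y\<in>ball a (2 * \<rho>). \<bar>affine_gap f x p y\<bar> \<le> affine_gap \<phi> x q y"
      using DC_locally_controlled[OF assms] by metis
    show ?thesis
    proof (rule exI[of _ \<rho>], rule conjI)
      show "tubes_of_order DIM('a) (?T a \<rho>)"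
        by (rule controlled_slopes_tube_bound[where a = a and \<rho> = \<rho> and \<phi> = \<phi> and M = M and f = f])
          (use * in auto)
    qed (rule *(1))
  qed
  then have "\<forall>a. \<exists>\<rho>. 0 < \<rho> \<and> tubes_of_order DIM('a) (?T a \<rho>)" by blast
  then have "\<exists>\<rho>. \<forall>a. 0 < \<rho> a \<and> tubes_of_order DIM('a) (?T a (\<rho> a))" by (rule choice)
  then obtain \<rho> where \<rho>: "\<And>a. 0 < \<rho> a" and tubes: "\<And>a. tubes_of_order DIM('a) (?T a (\<rho> a))"
    by blast
  have comp: "compact (fst ` K)"
    using \<open>compact K\<close> by (intro compact_continuous_image continuous_intros)
  have cover: "fst ` K \<subseteq> (\<Union>a\<in>fst ` K. ball a (\<rho> a))"
    using \<rho> by force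
  obtain I where "I \<subseteq> fst ` K" "finite I" and I: "fst ` K \<subseteq> (\<Union>a\<in>I. ball a (\<rho> a))"
    by (rule compactE_image[OF comp open_ball cover])
  show "finite_content DIM('a) (clarke_graph f \<inter> K)"
  proof (rule finite_content_of_tube_cover[OF \<open>finite I\<close>])
    show "clarke_graph f \<inter> K \<subseteq> (\<Union>a\<in>I. ?T a (\<rho> a))"
    proof
      fix z assume "z \<in> clarke_graph f \<inter> K"
      then have "fst z \<in> fst ` K" "snd z \<in> clarke_diff f (fst z)"
        by (auto simp: clarke_graph_def)
      moreover from this I obtain a where "a \<in> I" "fst z \<in> ball a (\<rho> a)" by blast
      ultimately show "z \<in> (\<Union>a\<in>I. ?T a (\<rho> a))" by (force simp: case_prod_beta)
    qed
  qed (use tubes in auto)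
qed

theorem lemma3p5:
  fixes f :: "real ^ 'd \<Rightarrow> real"
  assumes "DC f"
  shows "locally_finite_content CARD('d) (clarke_graph f)"
  using clarke_graph_locally_finite_content[OF assms] by simp

end
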